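(* Let $0\to\mathfrak{h}_S\xrightarrow{i}\mathfrak{e}_U\xrightarrow{p}\mathfrak{g}_T\to0$ be an abelian extension of the Rota-Baxter Lie algebra $\mathfrak{g}_T$ by a representation $\mathfrak{h}_S$ with action map $\psi$. Then there is an exact sequence $$1\to\mathrm{Aut}_\mathfrak{h}^{\mathfrak{h},\mathfrak{g}}(\mathfrak{e}_U)\xrightarrow{\iota}\mathrm{Aut}_\mathfrak{h}(\mathfrak{e}_U)\xrightarrow{\tau}C_\psi\xrightarrow{\mathcal{W}}H^2_{\mathrm{RBLie}}(\mathfrak{g}_T,\mathfrak{h}_S),$$ where $\iota$ is the inclusion and exactness at $C_\psi$ means $\mathrm{im}(\tau)=\{(\beta,\alpha)\in C_\psi\mid\mathcal{W}((\beta,\alpha))=0\}$.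
   Context: All vector spaces, linear maps and Lie algebras are over a field $\mathbf{k}$ of characteristic $0$. A Rota-Baxter Lie algebra $\mathfrak{g}_T$ is a Lie algebra $\mathfrak{g}$ with a linear map $T:\mathfrak{g}\to\mathfrak{g}$ satisfying $[T(x),T(y)]_\mathfrak{g}=T([T(x),y]_\mathfrak{g}+[x,T(y)]_\mathfrak{g})$ for all $x,y\in\mathfrak{g}$. A morphism $\mathfrak{g}_T\to\mathfrak{g}'_{T'}$ is a Lie algebra homomorphism $\varphi$ with $T'\circ\varphi=\varphi\circ T$; $\mathrm{Aut}(\mathfrak{g}_T)$ is the group of bijective morphisms $\mathfrak{g}_T\to\mathfrak{g}_T$. A representation $\mathfrak{h}_S$ of $\mathfrak{g}_T$ is a vector space $\mathfrak{h}$ with a Lie algebra homomorphism $\psi:\mathfrak{g}\to\mathrm{End}(\mathfrak{h})$ and a linear map $S:\mathfrak{h}\to\mathfrak{h}$ such that $\psi_{T(x)}S(h)=S(\psi_{T(x)}h+\psi_xS(h))$ for all $x\in\mathfrak{g}$, $h\in\mathfrak{h}$. Such $\mathfrak{h}_S$ is viewed as a Rota-Baxter Lie algebra with zero bracket (so $\mathrm{Aut}(\mathfrak{h}_S)$ consists of linear bijections commuting with $S$). An abelian extension of $\mathfrak{g}_T$ by the representation $\mathfrak{h}_S$ is a Rota-Baxter Lie algebra $\mathfrak{e}_U$ with a short exact sequence $0\to\mathfrak{h}_S\xrightarrow{i}\mathfrak{e}_U\xrightarrow{p}\mathfrak{g}_T\to0$ of morphisms of Rota-Baxter Lie algebras ($\mathfrak{h}$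 with zero bracket, identified with $i(\mathfrak{h})$) such that $\psi_xh=[s(x),h]_\mathfrak{e}$ for any section $s$ of $p$, i.e. linear $s:\mathfrak{g}\to\mathfrak{e}$ with $p\circ s=\mathrm{id}_\mathfrak{g}$ (this is independent of $s$). $\mathrm{Aut}_\mathfrak{h}(\mathfrak{e}_U)$ is the group of $\gamma\in\mathrm{Aut}(\mathfrak{e}_U)$ with $\gamma(\mathfrak{h})=\mathfrak{h}$; $\tau(\gamma)=(\gamma|_\mathfrak{h},p\gamma s)$, a group homomorphism $\mathrm{Aut}_\mathfrak{h}(\mathfrak{e}_U)\to\mathrm{Aut}(\mathfrak{h}_S)\times\mathrm{Aut}(\mathfrak{g}_T)$ (independent of $s$), whose image lies in the subgroup $C_\psi=\{(\beta,\alpha)\in\mathrm{Aut}(\mathfrak{h}_S)\times\mathrm{Aut}(\mathfrak{g}_T)\mid\beta(\psi_xh)=\psi_{\alpha(x)}\beta(h)\ \forall x\in\mathfrak{g},h\in\mathfrak{h}\}$. $\mathrm{Aut}_\mathfrak{h}^{\mathfrak{h},\mathfrak{g}}(\mathfrak{e}_U)=\{\gamma\in\mathrm{Aut}_\mathfrak{h}(\mathfrak{e}_U)\mid\tau(\gamma)=(\mathrm{id}_\mathfrak{h},\mathrm{id}_\mathfrak{g})\}$. A $2$-cocycle of $\mathfrak{g}_T$ with coefficients in $\mathfrak{h}_S$ is a pair $(\chi,\Phi)$ of linear maps $\chi:\wedge^2\mathfrak{g}\to\mathfrak{h}$, $\Phi:\mathfrak{g}\to\mathfrak{h}$ such that $\chi$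 is a Chevalley-Eilenberg $2$-cocycle of $\mathfrak{g}$ with coefficients in $(\mathfrak{h},\psi)$ and, for all $x,y\in\mathfrak{g}$, $\psi_{T(x)}\Phi(y)-\psi_{T(y)}\Phi(x)-S(\psi_x\Phi(y)-\psi_y\Phi(x))-\Phi([T(x),y]_\mathfrak{g}+[x,T(y)]_\mathfrak{g})+\chi(T(x),T(y))-S(\chi(T(x),y)+\chi(x,T(y)))=0$. The $2$-coboundaries are the pairs $(\delta^1f,\,S\circ f-f\circ T)$ for $f:\mathfrak{g}\to\mathfrak{h}$ linear, with $\delta^1f(x,y)=\psi_xf(y)-\psi_yf(x)-f([x,y]_\mathfrak{g})$. $H^2_{\mathrm{RBLie}}(\mathfrak{g}_T,\mathfrak{h}_S)$ is the quotient vector space of $2$-cocycles by $2$-coboundaries. Fix a section $s$, and let $\chi(x,y)=[s(x),s(y)]_\mathfrak{e}-s[x,y]_\mathfrak{g}$, $\Phi(x)=U(s(x))-s(T(x))$, a $2$-cocycle. For $(\beta,\alpha)\in C_\psi$, $\chi_{(\beta,\alpha)}(x,y)=\beta\chi(\alpha^{-1}(x),\alpha^{-1}(y))$ and $\Phi_{(\beta,\alpha)}(x)=\beta\Phi(\alpha^{-1}(x))$ form a $2$-cocycle, and the Wells map is the set map $\mathcal{W}((\beta,\alpha))=[(\chi_{(\beta,\alpha)},\Phi_{(\beta,\alpha)})-(\chi,\Phi)]$. *)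

theory Defs
  imports Complex_Main "HOL-Algebra.QuotRing" "HOL-Algebra.Module"
    "HOL-Library.Function_Algebras" "HOL-Library.Product_Plus"
begin

text \<open>
  Vector spaces are whole types of class \<open>ab_group_add\<close> with an explicit scalar multiplication
  satisfying the library locale \<open>vector_space\<close>.  Cochains are functions, added pointwise.
\<close>

record ('k, 'a) rb_lie =
  rb_scale :: "'k \<Rightarrow> 'a \<Rightarrow> 'a"
  rb_bracket :: "'a \<Rightarrow> 'a \<Rightarrow> 'a"
  rb_op :: "'a \<Rightarrow> 'a"

locale lie_algebra = vector_space scale
  for scale :: "'k::field_char_0 \<Rightarrow> 'a::ab_group_add \<Rightarrow> 'a" +
  fixes bracket :: "'a \<Rightarrow> 'a \<Rightarrow> 'a"
  assumes bracket_linear_left: "Vector_Spaces.linear scale scale (\<lambda>x. bracket x y)"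
    and bracket_linear_right: "Vector_Spaces.linear scale scale (\<lambda>y. bracket x y)"
    and bracket_self: "bracket x x = 0"
    and jacobi: "bracket x (bracket y z) + bracket y (bracket z x) + bracket z (bracket x y) = 0"

locale rb_lie_algebra =
  fixes L :: "('k::field_char_0, 'a::ab_group_add) rb_lie"
  assumes lie: "lie_algebra (rb_scale L) (rb_bracket L)"
    and rb_op_linear: "Vector_Spaces.linear (rb_scale L) (rb_scale L) (rb_op L)"
    and rota_baxter: "rb_bracket L (rb_op L x) (rb_op L y)
      = rb_op L (rb_bracket L (rb_op L x) y + rb_bracket L x (rb_op L y))"

definition rb_morphism ::
  "('k::field_char_0, 'a::ab_group_add) rb_lie \<Rightarrow> ('k, 'b::ab_group_add) rb_lie \<Rightarrow> ('a \<Rightarrow> 'b) \<Rightarrow> bool"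
  where "rb_morphism L M \<phi> \<longleftrightarrow>
    Vector_Spaces.linear (rb_scale L) (rb_scale M) \<phi> \<and>
    (\<forall>x y. \<phi> (rb_bracket L x y) = rb_bracket M (\<phi> x) (\<phi> y)) \<and>
    rb_op M \<circ> \<phi> = \<phi> \<circ> rb_op L"

definition rb_aut :: "('k::field_char_0, 'a::ab_group_add) rb_lie \<Rightarrow> ('a \<Rightarrow> 'a) monoid"
  where "rb_aut L = \<lparr>carrier = {\<phi>. rb_morphism L L \<phi> \<and> bij \<phi>}, mult = (\<circ>), one = id\<rparr>"

definition rb_abelian :: "('k \<Rightarrow> 'h::ab_group_add \<Rightarrow> 'h) \<Rightarrow> ('h \<Rightarrow> 'h) \<Rightarrow> ('k, 'h) rb_lie"
  where "rb_abelian sc S = \<lparr>rb_scale = sc, rb_bracket = (\<lambda>_ _. 0), rb_op = S\<rparr>"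

text \<open>\<open>rep_linear\<close>, \<open>rep_endo\<close> and \<open>rep_bracket\<close> together say that \<open>\<psi>\<close> is a Lie algebra
  homomorphism into the linear endomorphisms with the commutator bracket.\<close>

locale rb_representation =
  fixes G :: "('k::field_char_0, 'g::ab_group_add) rb_lie"
    and sc :: "'k \<Rightarrow> 'h::ab_group_add \<Rightarrow> 'h"
    and S :: "'h \<Rightarrow> 'h"
    and \<psi> :: "'g \<Rightarrow> 'h \<Rightarrow> 'h"
  assumes rep_vector_space: "vector_space sc"
    and rep_endo: "Vector_Spaces.linear sc sc (\<psi> x)"
    and rep_linear: "Vector_Spaces.linear (rb_scale G) sc (\<lambda>x. \<psi> x h)"
    and rep_bracket: "\<psi> (rb_bracket G x y) h = \<psi> x (\<psi> y h) - \<psi> y (\<psi> x h)"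
    and rep_op_linear: "Vector_Spaces.linear sc sc S"
    and rep_rota_baxter: "\<psi> (rb_op G x) (S h) = S (\<psi> (rb_op G x) h + \<psi> x (S h))"

definition rb_section ::
  "('k::field_char_0, 'g::ab_group_add) rb_lie \<Rightarrow> ('k, 'e::ab_group_add) rb_lie
    \<Rightarrow> ('e \<Rightarrow> 'g) \<Rightarrow> ('g \<Rightarrow> 'e) \<Rightarrow> bool"
  where "rb_section G E p s \<longleftrightarrow>
    Vector_Spaces.linear (rb_scale G) (rb_scale E) s \<and> p \<circ> s = id"

locale rb_abelian_extension =
  fixes G :: "('k::field_char_0, 'g::ab_group_add) rb_lie"
    and sc :: "'k \<Rightarrow> 'h::ab_group_add \<Rightarrow> 'h"
    and S :: "'h \<Rightarrow> 'h"
    and \<psi> :: "'g \<Rightarrow> 'h \<Rightarrow> 'h"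
    and E :: "('k, 'e::ab_group_add) rb_lie"
    and i :: "'h \<Rightarrow> 'e"
    and p :: "'e \<Rightarrow> 'g"
  assumes ext_base: "rb_lie_algebra G"
    and ext_rep: "rb_representation G sc S \<psi>"
    and ext_total: "rb_lie_algebra E"
    and ext_i: "rb_morphism (rb_abelian sc S) E i"
    and ext_p: "rb_morphism E G p"
    and ext_inj: "inj i"
    and ext_exact: "range i = {e. p e = 0}"
    and ext_surj: "surj p"
    and ext_action: "rb_section G E p s \<Longrightarrow> i (\<psi> x h) = rb_bracket E (s x) (i h)"


definition aut_ext ::
  "('k::field_char_0, 'e::ab_group_add) rb_lie \<Rightarrow> ('h \<Rightarrow> 'e) \<Rightarrow> ('e \<Rightarrow> 'e) monoid"
  where "aut_ext E i = (rb_aut E)\<lparr>carrier := {\<gamma> \<in> carrier (rb_aut E). \<gamma> ` range i = range i}\<rparr>"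

text \<open>Functions with values in the subspace \<open>range i\<close> are read as \<open>'h\<close>-valued through the
  inverse of \<open>i\<close>; in particular the restriction of \<open>\<gamma>\<close> to \<open>'h\<close> is \<open>i\<inverse> \<circ> \<gamma> \<circ> i\<close>.\<close>

definition tau ::
  "('h \<Rightarrow> 'e) \<Rightarrow> ('e \<Rightarrow> 'g) \<Rightarrow> ('g \<Rightarrow> 'e) \<Rightarrow> ('e \<Rightarrow> 'e) \<Rightarrow> ('h \<Rightarrow> 'h) \<times> ('g \<Rightarrow> 'g)"
  where "tau i p s \<gamma> = (inv_into UNIV i \<circ> \<gamma> \<circ> i, p \<circ> \<gamma> \<circ> s)"

definition aut_ext_fix ::
  "('k::field_char_0, 'e::ab_group_add) rb_lie \<Rightarrow> ('h \<Rightarrow> 'e) \<Rightarrow> ('e \<Rightarrow> 'g) \<Rightarrow> ('g \<Rightarrow> 'e)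
    \<Rightarrow> ('e \<Rightarrow> 'e) monoid"
  where "aut_ext_fix E i p s =
    (aut_ext E i)\<lparr>carrier := {\<gamma> \<in> carrier (aut_ext E i). tau i p s \<gamma> = (id, id)}\<rparr>"

definition compatible_pairs ::
  "('k::field_char_0, 'g::ab_group_add) rb_lie \<Rightarrow> ('k \<Rightarrow> 'h::ab_group_add \<Rightarrow> 'h) \<Rightarrow> ('h \<Rightarrow> 'h)
    \<Rightarrow> ('g \<Rightarrow> 'h \<Rightarrow> 'h) \<Rightarrow> (('h \<Rightarrow> 'h) \<times> ('g \<Rightarrow> 'g)) monoid"
  where "compatible_pairs G sc S \<psi> =
    (rb_aut (rb_abelian sc S) \<times>\<times> rb_aut G)\<lparr>carrier :=
      {(\<beta>, \<alpha>) \<in> carrier (rb_aut (rb_abelian sc S)) \<times> carrier (rb_aut G).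
         \<forall>x h. \<beta> (\<psi> x h) = \<psi> (\<alpha> x) (\<beta> h)}\<rparr>"


type_synonym ('g, 'h) cochain2 = "('g \<Rightarrow> 'g \<Rightarrow> 'h) \<times> ('g \<Rightarrow> 'h)"

definition ce_cocycle2 ::
  "('k::field_char_0, 'g::ab_group_add) rb_lie \<Rightarrow> ('k \<Rightarrow> 'h::ab_group_add \<Rightarrow> 'h)
    \<Rightarrow> ('g \<Rightarrow> 'h \<Rightarrow> 'h) \<Rightarrow> ('g \<Rightarrow> 'g \<Rightarrow> 'h) \<Rightarrow> bool"
  where "ce_cocycle2 G sc \<psi> \<chi> \<longleftrightarrow>
    (\<forall>y. Vector_Spaces.linear (rb_scale G) sc (\<lambda>x. \<chi> x y)) \<and>
    (\<forall>x. Vector_Spaces.linear (rb_scale G) sc (\<lambda>y. \<chi> x y)) \<and>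
    (\<forall>x. \<chi> x x = 0) \<and>
    (\<forall>x y z. \<psi> x (\<chi> y z) - \<psi> y (\<chi> x z) + \<psi> z (\<chi> x y)
       - \<chi> (rb_bracket G x y) z + \<chi> (rb_bracket G x z) y - \<chi> (rb_bracket G y z) x = 0)"

definition rb_cocycles2 ::
  "('k::field_char_0, 'g::ab_group_add) rb_lie \<Rightarrow> ('k \<Rightarrow> 'h::ab_group_add \<Rightarrow> 'h) \<Rightarrow> ('h \<Rightarrow> 'h)
    \<Rightarrow> ('g \<Rightarrow> 'h \<Rightarrow> 'h) \<Rightarrow> ('g, 'h) cochain2 set"
  where "rb_cocycles2 G sc S \<psi> = {(\<chi>, \<Phi>).
    ce_cocycle2 G sc \<psi> \<chi> \<and> Vector_Spaces.linear (rb_scale G) sc \<Phi> \<and>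
    (\<forall>x y. \<psi> (rb_op G x) (\<Phi> y) - \<psi> (rb_op G y) (\<Phi> x) - S (\<psi> x (\<Phi> y) - \<psi> y (\<Phi> x))
       - \<Phi> (rb_bracket G (rb_op G x) y + rb_bracket G x (rb_op G y))
       + \<chi> (rb_op G x) (rb_op G y) - S (\<chi> (rb_op G x) y + \<chi> x (rb_op G y)) = 0)}"

definition rb_coboundaries2 ::
  "('k::field_char_0, 'g::ab_group_add) rb_lie \<Rightarrow> ('k \<Rightarrow> 'h::ab_group_add \<Rightarrow> 'h) \<Rightarrow> ('h \<Rightarrow> 'h)
    \<Rightarrow> ('g \<Rightarrow> 'h \<Rightarrow> 'h) \<Rightarrow> ('g, 'h) cochain2 set"
  where "rb_coboundaries2 G sc S \<psi> =
    {(\<lambda>x y. \<psi> x (f y) - \<psi> y (f x) - f (rb_bracket G x y), \<lambda>x. S (f x) - f (rb_op G x)) | f.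
       Vector_Spaces.linear (rb_scale G) sc f}"

text \<open>The multiplicative fields that the library's \<open>module\<close> record inherits from rings play no
  role for modules and are left undefined.\<close>

definition rb_cocycle_module ::
  "('k::field_char_0, 'g::ab_group_add) rb_lie \<Rightarrow> ('k \<Rightarrow> 'h::ab_group_add \<Rightarrow> 'h) \<Rightarrow> ('h \<Rightarrow> 'h)
    \<Rightarrow> ('g \<Rightarrow> 'h \<Rightarrow> 'h) \<Rightarrow> ('k, ('g, 'h) cochain2) module"
  where "rb_cocycle_module G sc S \<psi> =
    \<lparr>carrier = rb_cocycles2 G sc S \<psi>, mult = undefined, one = undefined,
     zero = 0, add = (+),
     smult = (\<lambda>r (\<chi>, \<Phi>). (\<lambda>x y. sc r (\<chi> x y), \<lambda>x. sc r (\<Phi> x)))\<rparr>"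

definition quot_module :: "('k, 'v) module \<Rightarrow> 'v set \<Rightarrow> ('k, 'v set) module"
  where "quot_module Z B =
    \<lparr>carrier = a_rcosets\<^bsub>Z\<^esub> B, mult = undefined, one = undefined,
     zero = B, add = set_add Z,
     smult = (\<lambda>r X. \<Union>x\<in>X. B +>\<^bsub>Z\<^esub> (r \<odot>\<^bsub>Z\<^esub> x))\<rparr>"

definition H2_RBLie ::
  "('k::field_char_0, 'g::ab_group_add) rb_lie \<Rightarrow> ('k \<Rightarrow> 'h::ab_group_add \<Rightarrow> 'h) \<Rightarrow> ('h \<Rightarrow> 'h)
    \<Rightarrow> ('g \<Rightarrow> 'h \<Rightarrow> 'h) \<Rightarrow> ('k, ('g, 'h) cochain2 set) module"
  where "H2_RBLie G sc S \<psi> =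
    quot_module (rb_cocycle_module G sc S \<psi>) (rb_coboundaries2 G sc S \<psi>)"

definition cohomology_class ::
  "('k::field_char_0, 'g::ab_group_add) rb_lie \<Rightarrow> ('k \<Rightarrow> 'h::ab_group_add \<Rightarrow> 'h) \<Rightarrow> ('h \<Rightarrow> 'h)
    \<Rightarrow> ('g \<Rightarrow> 'h \<Rightarrow> 'h) \<Rightarrow> ('g, 'h) cochain2 \<Rightarrow> ('g, 'h) cochain2 set"
  where "cohomology_class G sc S \<psi> c =
    rb_coboundaries2 G sc S \<psi> +>\<^bsub>rb_cocycle_module G sc S \<psi>\<^esub> c"

definition ext_cocycle ::
  "('k::field_char_0, 'g::ab_group_add) rb_lie \<Rightarrow> ('k, 'e::ab_group_add) rb_lie
    \<Rightarrow> ('h \<Rightarrow> 'e) \<Rightarrow> ('g \<Rightarrow> 'e) \<Rightarrow> ('g, 'h) cochain2"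
  where "ext_cocycle G E i s =
    (\<lambda>x y. inv_into UNIV i (rb_bracket E (s x) (s y) - s (rb_bracket G x y)),
     \<lambda>x. inv_into UNIV i (rb_op E (s x) - s (rb_op G x)))"

definition twist_cochain ::
  "('h \<Rightarrow> 'h) \<times> ('g \<Rightarrow> 'g) \<Rightarrow> ('g, 'h) cochain2 \<Rightarrow> ('g, 'h) cochain2"
  where "twist_cochain = (\<lambda>(\<beta>, \<alpha>) (\<chi>, \<Phi>).
    (\<lambda>x y. \<beta> (\<chi> (inv_into UNIV \<alpha> x) (inv_into UNIV \<alpha> y)),
     \<lambda>x. \<beta> (\<Phi> (inv_into UNIV \<alpha> x))))"

definition wells_map ::
  "('k::field_char_0, 'g::ab_group_add) rb_lie \<Rightarrow> ('k \<Rightarrow> 'h::ab_group_add \<Rightarrow> 'h) \<Rightarrow> ('h \<Rightarrow> 'h)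
    \<Rightarrow> ('g \<Rightarrow> 'h \<Rightarrow> 'h) \<Rightarrow> ('k, 'e::ab_group_add) rb_lie \<Rightarrow> ('h \<Rightarrow> 'e) \<Rightarrow> ('g \<Rightarrow> 'e)
    \<Rightarrow> ('h \<Rightarrow> 'h) \<times> ('g \<Rightarrow> 'g) \<Rightarrow> ('g, 'h) cochain2 set"
  where "wells_map G sc S \<psi> E i s c =
    cohomology_class G sc S \<psi> (twist_cochain c (ext_cocycle G E i s) - ext_cocycle G E i s)"

end

theory Submission
  imports Defs
begin

text \<open>
  The section \<open>s\<close> splits \<open>'e\<close> linearly: every element is \<open>s x + i h\<close> for a unique pair
  \<open>(x, h)\<close>. In these coordinates the structure of the extension is
  \<open>[s x + i h, s y + i k] = s [x, y] + i (\<chi> x y + \<psi> x k - \<psi> y h)\<close> and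
  \<open>U (s x + i h) = s (T x) + i (\<Phi> x + S h)\<close> (lemmas \<open>bracket_decomposed\<close> and
  \<open>op_decomposed\<close>), so the cocycle \<open>(\<chi>, \<Phi>)\<close> measures exactly how far \<open>s\<close> is from being a
  morphism.

  An automorphism preserving \<open>range i\<close> and inducing \<open>(\<beta>, \<alpha>)\<close> is block triangular in these
  coordinates, with diagonal blocks \<open>\<alpha>\<close> and \<open>\<beta>\<close>. The only freedom is the off-diagonal block,
  which can be written \<open>f \<circ> \<alpha>\<close> with \<open>f\<close> linear from \<open>'g\<close> to \<open>'h\<close>:
  \<open>s x + i h \<mapsto> s (\<alpha> x) + i (f (\<alpha> x) + \<beta> h)\<close>. Conversely, for a compatible pair \<open>(\<beta>, \<alpha>)\<close> and
  any linear \<open>f\<close> this formula defines a linear bijection inducing \<open>(\<beta>, \<alpha>)\<close>. Substituting it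
  into the two formulas above shows that it preserves the bracket and the operator if and only
  if the coboundary of \<open>f\<close> is the twisted cocycle minus the original one. This equivalence,
  \<open>lift_morphism_iff\<close>, gives both inclusions at \<open>C\<^sub>\<psi>\<close>: the pair comes from an automorphism
  if and only if some \<open>f\<close> bounds the difference, that is, if and only if its class vanishes
  (\<open>wells_map_zero_iff\<close>). Exactness at the other two places only says that a subgroup is
  included injectively and that it is the kernel of \<open>tau\<close>.
\<close>

section \<open>Linear maps and automorphism groups\<close>

lemma linear_preserves:
  assumes "Vector_Spaces.linear s1 s2 f"
  shows "f 0 = 0" "f (x + y) = f x + f y" "f (x - y) = f x - f y" "f (- x) = - f x"
    "f (s1 c x) = s2 c (f x)"
proof -
  interpret Vector_Spaces.linear s1 s2 f by (rule assms)
  show "f 0 = 0" "f (x + y) = f x + f y" "f (x - y) = f x - f y" "f (- x) = - f x"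
    "f (s1 c x) = s2 c (f x)"
    by (simp_all add: add diff neg scale)
qed

lemma (in lie_algebra) bracket_skew: "bracket y x = - bracket x y"
proof -
  have "bracket (x + y) (x + y) = bracket x x + bracket y x + (bracket x y + bracket y y)"
    by (simp only: linear_preserves(2)[OF bracket_linear_left]
        linear_preserves(2)[OF bracket_linear_right])
  then have "bracket y x + bracket x y = 0"
    by (simp add: bracket_self)
  then show ?thesis by (simp add: eq_neg_iff_add_eq_0)
qed

lemma rb_morphism_comp:
  "rb_morphism L M \<phi> \<Longrightarrow> rb_morphism M N \<phi>' \<Longrightarrow> rb_morphism L N (\<phi>' \<circ> \<phi>)"
  unfolding rb_morphism_def
  by (auto simp: fun_eq_iff intro: Vector_Spaces.linear_compose)

lemma rb_morphism_inverse:
  assumes "rb_morphism L M \<phi>" and inv: "\<phi>' \<circ> \<phi> = id" "\<phi> \<circ> \<phi>' = id"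
  shows "rb_morphism M L \<phi>'"
proof -
  have lin: "Vector_Spaces.linear (rb_scale L) (rb_scale M) \<phi>"
    and br: "\<And>x y. \<phi> (rb_bracket L x y) = rb_bracket M (\<phi> x) (\<phi> y)"
    and op: "\<And>x. rb_op M (\<phi> x) = \<phi> (rb_op L x)"
    using assms(1) by (auto simp: rb_morphism_def fun_eq_iff)
  have l: "\<phi>' (\<phi> x) = x" and r: "\<phi> (\<phi>' y) = y" for x y
    using inv by (simp_all add: fun_eq_iff)
  have "\<phi>' (y + z) = \<phi>' y + \<phi>' z" "\<phi>' (rb_scale M c y) = rb_scale L c (\<phi>' y)"
    "\<phi>' (rb_bracket M y z) = rb_bracket L (\<phi>' y) (\<phi>' z)"
    "\<phi>' (rb_op M y) = rb_op L (\<phi>' y)" for y z c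
    by (metis l r linear_preserves(2)[OF lin], metis l r linear_preserves(5)[OF lin],
        metis l r br, metis l r op)
  then show ?thesis
    using lin by (auto simp: rb_morphism_def Vector_Spaces.linear_iff fun_eq_iff)
qed

lemma inv_into_UNIV_comp:
  assumes "bij f" shows "inv_into UNIV f \<circ> f = id" "f \<circ> inv_into UNIV f = id"
  using assms by (simp_all add: bij_is_inj bij_is_surj surj_iff[symmetric])

lemma group_rb_aut:
  assumes "vector_space (rb_scale L)"
  shows "group (rb_aut L)"
proof (rule groupI)
  show "\<one>\<^bsub>rb_aut L\<^esub> \<in> carrier (rb_aut L)"
    using assms by (auto simp: rb_aut_def rb_morphism_def Vector_Spaces.linear_iff)
next
  fix \<gamma> assume "\<gamma> \<in> carrier (rb_aut L)"
  then have \<gamma>: "rb_morphism L L \<gamma>" "bij \<gamma>" by (auto simp: rb_aut_def)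
  then have "rb_morphism L L (inv_into UNIV \<gamma>)" "bij (inv_into UNIV \<gamma>)"
    by (auto intro: rb_morphism_inverse inv_into_UNIV_comp bij_imp_bij_inv)
  then show "\<exists>\<gamma>'\<in>carrier (rb_aut L). \<gamma>' \<otimes>\<^bsub>rb_aut L\<^esub> \<gamma> = \<one>\<^bsub>rb_aut L\<^esub>"
    using inv_into_UNIV_comp[OF \<gamma>(2)]
    by (intro bexI[of _ "inv_into UNIV \<gamma>"]) (auto simp: rb_aut_def)
qed (auto simp: rb_aut_def comp_assoc intro: rb_morphism_comp bij_comp)

lemma rb_aut_inv:
  assumes "vector_space (rb_scale L)" "\<gamma> \<in> carrier (rb_aut L)"
  shows "inv\<^bsub>rb_aut L\<^esub> \<gamma> = inv_into UNIV \<gamma>"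
proof (rule group.inv_equality[OF group_rb_aut[OF assms(1)]])
  have \<gamma>: "rb_morphism L L \<gamma>" "bij \<gamma>" using assms(2) by (auto simp: rb_aut_def)
  show "inv_into UNIV \<gamma> \<otimes>\<^bsub>rb_aut L\<^esub> \<gamma> = \<one>\<^bsub>rb_aut L\<^esub>"
    using inv_into_UNIV_comp[OF \<gamma>(2)] by (simp add: rb_aut_def)
  show "inv_into UNIV \<gamma> \<in> carrier (rb_aut L)"
    using \<gamma> by (auto simp: rb_aut_def intro: rb_morphism_inverse inv_into_UNIV_comp bij_imp_bij_inv)
qed (fact assms)

lemma group_aut_ext:
  assumes "vector_space (rb_scale E)"
  shows "group (aut_ext E i)"
  unfolding aut_ext_def
proof (rule subgroup.subgroup_is_group[OF _ group_rb_aut[OF assms]],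
    rule group.subgroupI[OF group_rb_aut[OF assms]])
  let ?H = "{\<gamma> \<in> carrier (rb_aut E). \<gamma> ` range i = range i}"
  have "id \<in> ?H"
    using group.is_monoid[OF group_rb_aut[OF assms], THEN monoid.one_closed] by (simp add: rb_aut_def)
  then show "?H \<noteq> {}" by blast
  show "inv\<^bsub>rb_aut E\<^esub> \<gamma> \<in> ?H" if "\<gamma> \<in> ?H" for \<gamma>
  proof -
    from that have c: "\<gamma> \<in> carrier (rb_aut E)" and eq: "\<gamma> ` range i = range i" by auto
    then have "inj \<gamma>" by (simp add: rb_aut_def bij_is_inj)
    then have "inv_into UNIV \<gamma> ` range i = range i"
      using eq image_inv_f_f by metis
    then show ?thesis
      using c group.inv_closed[OF group_rb_aut[OF assms] c] by (simp add: rb_aut_inv[OF assms c])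
  qed
  show "\<gamma> \<otimes>\<^bsub>rb_aut E\<^esub> \<gamma>' \<in> ?H" if "\<gamma> \<in> ?H" "\<gamma>' \<in> ?H" for \<gamma> \<gamma>'
  proof -
    have "(\<gamma> \<circ> \<gamma>') ` range i = range i"
      using that by (simp only: image_comp[symmetric] mem_Collect_eq)
    then show ?thesis
      using that by (auto simp: rb_aut_def intro: rb_morphism_comp bij_comp)
  qed
qed auto

section \<open>An extension with a chosen section\<close>

locale rb_split_extension = rb_abelian_extension G sc S \<psi> E i p
  for G :: "('k::field_char_0, 'g::ab_group_add) rb_lie"
    and sc :: "'k \<Rightarrow> 'h::ab_group_add \<Rightarrow> 'h"
    and S \<psi>
    and E :: "('k, 'e::ab_group_add) rb_lie"
    and i p +
  fixes s :: "'g \<Rightarrow> 'e"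
  assumes sec: "rb_section G E p s"
begin

abbreviation "bG \<equiv> rb_bracket G"
abbreviation "bE \<equiv> rb_bracket E"
abbreviation "T \<equiv> rb_op G"
abbreviation "U \<equiv> rb_op E"
abbreviation "scG \<equiv> rb_scale G"
abbreviation "scE \<equiv> rb_scale E"

lemma lin_maps:
  shows lin_s: "Vector_Spaces.linear scG scE s"
    and lin_i: "Vector_Spaces.linear sc scE i"
    and lin_p: "Vector_Spaces.linear scE scG p"
    and lin_S: "Vector_Spaces.linear sc sc S"
    and lin_T: "Vector_Spaces.linear scG scG T"
    and lin_U: "Vector_Spaces.linear scE scE U"
    and lin_\<psi>1: "\<And>h. Vector_Spaces.linear scG sc (\<lambda>x. \<psi> x h)"
    and lin_\<psi>2: "\<And>x. Vector_Spaces.linear sc sc (\<psi> x)"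
    and lin_bG1: "\<And>y. Vector_Spaces.linear scG scG (\<lambda>x. bG x y)"
    and lin_bG2: "\<And>x. Vector_Spaces.linear scG scG (\<lambda>y. bG x y)"
    and lin_bE1: "\<And>y. Vector_Spaces.linear scE scE (\<lambda>x. bE x y)"
    and lin_bE2: "\<And>x. Vector_Spaces.linear scE scE (\<lambda>y. bE x y)"
  using sec ext_i ext_p ext_rep ext_base ext_total
    lie_algebra.bracket_linear_left[OF rb_lie_algebra.lie]
    lie_algebra.bracket_linear_right[OF rb_lie_algebra.lie]
  by (auto simp: rb_section_def rb_morphism_def rb_abelian_def rb_representation_def
      rb_lie_algebra_def)

lemmas lin_simps = lin_maps[THEN linear_preserves(1)] lin_maps[THEN linear_preserves(2)]
  lin_maps[THEN linear_preserves(3)] lin_maps[THEN linear_preserves(4)]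

lemmas scale_simps = lin_maps[THEN linear_preserves(5)]

lemma spaces: "vector_space scG" "vector_space sc" "vector_space scE"
  using lin_s lin_i by (simp_all add: Vector_Spaces.linear_iff)

lemma p_s [simp]: "p (s x) = x"
  using sec by (simp add: rb_section_def fun_eq_iff)

lemma p_i [simp]: "p (i h) = 0"
  using ext_exact by auto

lemma i_eq_iff [simp]: "i h = i k \<longleftrightarrow> h = k"
  using ext_inj by (simp add: inj_eq)

lemma i_eq_0_iff [simp]: "i h = 0 \<longleftrightarrow> h = 0"
  using i_eq_iff[of h 0] by (simp add: linear_preserves(1)[OF lin_i])

lemma p_bracket: "p (bE d e) = bG (p d) (p e)"
  and p_op: "p (U e) = T (p e)"
  and i_op: "U (i h) = i (S h)"
  using ext_p ext_i by (simp_all add: rb_morphism_def rb_abelian_def fun_eq_iff)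

lemma bracket_i_i: "bE (i h) (i k) = 0"
  using ext_i by (auto simp: rb_morphism_def rb_abelian_def lin_simps fun_eq_iff)

lemma bracket_s_i: "bE (s x) (i h) = i (\<psi> x h)"
  using ext_action[OF sec] by simp

lemma bracket_skew_E: "bE e d = - bE d e"
  by (rule lie_algebra.bracket_skew[OF rb_lie_algebra.lie[OF ext_total]])

lemma bracket_skew_G: "bG y x = - bG x y"
  by (rule lie_algebra.bracket_skew[OF rb_lie_algebra.lie[OF ext_base]])

lemma bracket_i_s: "bE (i h) (s x) = - i (\<psi> x h)"
  using bracket_skew_E bracket_s_i by metis

text \<open>The projection of \<open>'e\<close> onto \<open>'h\<close> along the image of the section.\<close>

definition fib :: "'e \<Rightarrow> 'h" where "fib e = inv_into UNIV i (e - s (p e))"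

lemma i_inv_into: "p e = 0 \<Longrightarrow> i (inv_into UNIV i e) = e"
  using ext_exact by (auto intro: f_inv_into_f)

lemma i_fib: "i (fib e) = e - s (p e)"
  unfolding fib_def by (rule i_inv_into) (simp add: lin_simps)

lemma decompose: "e = s (p e) + i (fib e)"
  by (simp add: i_fib)

lemma fib_s_i [simp]: "fib (s x + i h) = h"
  unfolding i_eq_iff[symmetric] i_fib by (simp add: lin_simps)

lemma linear_fib: "Vector_Spaces.linear scE sc fib"
  unfolding Vector_Spaces.linear_iff
proof (intro conjI allI spaces)
  fix d e c
  show "fib (d + e) = fib d + fib e" "fib (scE c e) = sc c (fib e)"
    unfolding i_eq_iff[symmetric]
    by (simp_all add: i_fib lin_simps scale_simps module.scale_right_diff_distrib
        spaces module_iff_vector_space)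
qed

lemmas fib_simps = linear_fib[THEN linear_preserves(1)] linear_fib[THEN linear_preserves(2)]
  linear_fib[THEN linear_preserves(3)] linear_fib[THEN linear_preserves(4)]

definition \<chi> :: "'g \<Rightarrow> 'g \<Rightarrow> 'h" where "\<chi> = fst (ext_cocycle G E i s)"
definition \<Phi> :: "'g \<Rightarrow> 'h" where "\<Phi> = snd (ext_cocycle G E i s)"

lemma ext_cocycle_eq: "ext_cocycle G E i s = (\<chi>, \<Phi>)"
  by (simp add: \<chi>_def \<Phi>_def)

lemma i_\<chi>: "i (\<chi> x y) = bE (s x) (s y) - s (bG x y)"
  unfolding \<chi>_def ext_cocycle_def fst_conv by (rule i_inv_into) (simp add: lin_simps p_bracket)

lemma i_\<Phi>: "i (\<Phi> x) = U (s x) - s (T x)"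
  unfolding \<Phi>_def ext_cocycle_def snd_conv by (rule i_inv_into) (simp add: lin_simps p_op)

lemma bracket_s_s: "bE (s x) (s y) = s (bG x y) + i (\<chi> x y)"
  by (simp add: i_\<chi>)

lemma op_s: "U (s x) = s (T x) + i (\<Phi> x)"
  by (simp add: i_\<Phi>)

lemma bracket_decomposed:
  "bE (s x + i h) (s y + i k) = s (bG x y) + i (\<chi> x y + \<psi> x k - \<psi> y h)"
  by (simp add: lin_simps bracket_s_s bracket_s_i bracket_i_s bracket_i_i)

lemma op_decomposed: "U (s x + i h) = s (T x) + i (\<Phi> x + S h)"
  by (simp add: lin_simps op_s i_op)

lemma decomposed_eq_iff [simp]: "s x + i h = s y + i k \<longleftrightarrow> x = y \<and> h = k"
  by (metis add.right_neutral fib_s_i linear_preserves(2)[OF lin_p] p_i p_s)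

section \<open>The cocycle of the extension\<close>

text \<open>The cocycle identity is the \<open>'h\<close>-component of the Jacobi identity in \<open>'e\<close> for
  \<open>s x\<close>, \<open>s y\<close>, \<open>s z\<close>. This component comes out in cyclic form; skew-symmetry brings it into the
  shape of the Chevalley-Eilenberg differential.\<close>

lemma ce_cocycle_\<chi>: "ce_cocycle2 G sc \<psi> \<chi>"
  unfolding ce_cocycle2_def
proof (intro conjI allI)
  show "Vector_Spaces.linear scG sc (\<lambda>x. \<chi> x y)" "Vector_Spaces.linear scG sc (\<lambda>y. \<chi> x y)" for x y
    unfolding Vector_Spaces.linear_iff i_eq_iff[symmetric]
    by (simp_all add: spaces i_\<chi> lin_simps scale_simps module.scale_right_diff_distrib
        module_iff_vector_space)
  show "\<chi> x x = 0" for x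
    unfolding i_eq_iff[symmetric]
    by (simp add: i_\<chi> lin_simps lie_algebra.bracket_self[OF rb_lie_algebra.lie] ext_base ext_total)
  fix x y z
  have jacobi_E: "bE (s x) (bE (s y) (s z)) + bE (s y) (bE (s z) (s x)) + bE (s z) (bE (s x) (s y)) = 0"
    by (rule lie_algebra.jacobi[OF rb_lie_algebra.lie[OF ext_total]])
  have jacobi_G: "bG x (bG y z) + bG y (bG z x) + bG z (bG x y) = 0"
    by (rule lie_algebra.jacobi[OF rb_lie_algebra.lie[OF ext_base]])
  have "bE (s x + i 0) (bE (s y + i 0) (s z + i 0)) + bE (s y + i 0) (bE (s z + i 0) (s x + i 0))
      + bE (s z + i 0) (bE (s x + i 0) (s y + i 0)) = 0"
    using jacobi_E by (simp add: lin_simps)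
  then have "s (bG x (bG y z) + bG y (bG z x) + bG z (bG x y))
     + i (\<psi> x (\<chi> y z) + \<chi> x (bG y z) + \<psi> y (\<chi> z x) + \<chi> y (bG z x) + \<psi> z (\<chi> x y) + \<chi> z (bG x y)) = 0"
    unfolding bracket_decomposed by (simp add: lin_simps algebra_simps)
  then have cyclic: "\<psi> x (\<chi> y z) + \<chi> x (bG y z) + \<psi> y (\<chi> z x) + \<chi> y (bG z x) + \<psi> z (\<chi> x y) + \<chi> z (bG x y) = 0"
    by (simp add: jacobi_G lin_s[THEN linear_preserves(1)])
  have skew: "\<chi> v u = - \<chi> u v" for u v
    unfolding i_eq_iff[symmetric]
    by (simp add: i_\<chi> lin_simps bracket_skew_E[of "s v" "s u"] bracket_skew_G[of v u])
  have neg: "\<chi> (- u) v = - \<chi> u v" for u v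
    unfolding i_eq_iff[symmetric] by (simp add: i_\<chi> lin_simps)
  have "\<chi> y (bG z x) = \<chi> (bG x z) y"
    using skew[of y "bG z x"] neg[of "bG x z" y] by (simp add: bracket_skew_G[of z x])
  then show "\<psi> x (\<chi> y z) - \<psi> y (\<chi> x z) + \<psi> z (\<chi> x y)
     - \<chi> (bG x y) z + \<chi> (bG x z) y - \<chi> (bG y z) x = 0"
    using cyclic
    by (simp add: skew[of z x] skew[of x "bG y z"] skew[of z "bG x y"] lin_simps algebra_simps)
qed

text \<open>The condition linking \<open>\<chi>\<close> and \<open>\<Phi>\<close> is the \<open>'h\<close>-component of the Rota-Baxter identity in
  \<open>'e\<close> for \<open>s x\<close> and \<open>s y\<close>.\<close>

lemma ext_cocycle_in_cocycles: "(\<chi>, \<Phi>) \<in> rb_cocycles2 G sc S \<psi>"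
  unfolding rb_cocycles2_def mem_Collect_eq prod.case
proof (intro conjI allI ce_cocycle_\<chi>)
  show "Vector_Spaces.linear scG sc \<Phi>"
    unfolding Vector_Spaces.linear_iff i_eq_iff[symmetric]
    by (simp_all add: spaces i_\<Phi> lin_simps scale_simps module.scale_right_diff_distrib
        module_iff_vector_space)
  fix x y
  have "s (bG (T x) (T y)) + i (\<chi> (T x) (T y) + \<psi> (T x) (\<Phi> y) - \<psi> (T y) (\<Phi> x))
      = bE (U (s x)) (U (s y))"
    by (simp add: op_s bracket_decomposed)
  also have "\<dots> = U (bE (U (s x)) (s y) + bE (s x) (U (s y)))"
    by (rule rb_lie_algebra.rota_baxter[OF ext_total])
  also have "bE (U (s x)) (s y) + bE (s x) (U (s y))
      = s (bG (T x) y + bG x (T y)) + i (\<chi> (T x) y + \<chi> x (T y) + \<psi> x (\<Phi> y) - \<psi> y (\<Phi> x))"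
    using bracket_decomposed[of "T x" "\<Phi> x" y 0] bracket_decomposed[of x 0 "T y" "\<Phi> y"]
    by (simp add: op_s lin_simps algebra_simps)
  finally have "s (bG (T x) (T y)) + i (\<chi> (T x) (T y) + \<psi> (T x) (\<Phi> y) - \<psi> (T y) (\<Phi> x))
      = U (s (bG (T x) y + bG x (T y)) + i (\<chi> (T x) y + \<chi> x (T y) + \<psi> x (\<Phi> y) - \<psi> y (\<Phi> x)))" .
  then have "\<chi> (T x) (T y) + \<psi> (T x) (\<Phi> y) - \<psi> (T y) (\<Phi> x)
      = \<Phi> (bG (T x) y + bG x (T y)) + S (\<chi> (T x) y + \<chi> x (T y) + \<psi> x (\<Phi> y) - \<psi> y (\<Phi> x))"
    unfolding op_decomposed by simp
  then show "\<psi> (T x) (\<Phi> y) - \<psi> (T y) (\<Phi> x) - S (\<psi> x (\<Phi> y) - \<psi> y (\<Phi> x))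
     - \<Phi> (bG (T x) y + bG x (T y)) + \<chi> (T x) (T y) - S (\<chi> (T x) y + \<chi> x (T y)) = 0"
    by (simp add: lin_simps algebra_simps)
qed


section \<open>Cohomology classes and twisting by compatible pairs\<close>

lemma cocycles_diff:
  assumes "c \<in> rb_cocycles2 G sc S \<psi>" "d \<in> rb_cocycles2 G sc S \<psi>"
  shows "c - d \<in> rb_cocycles2 G sc S \<psi>"
proof -
  obtain \<chi>1 \<Phi>1 \<chi>2 \<Phi>2 where cd: "c = (\<chi>1, \<Phi>1)" "d = (\<chi>2, \<Phi>2)" by fastforce
  have sc_diff: "sc r (h - k) = sc r h - sc r k" for r h k
    using spaces by (simp add: module.scale_right_diff_distrib module_iff_vector_space)
  show ?thesis
    using assms unfolding cd rb_cocycles2_def ce_cocycle2_def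
    by (simp add: Vector_Spaces.linear_iff sc_diff lin_simps algebra_simps)
qed

lemma cohomology_class_eq:
  "cohomology_class G sc S \<psi> c = {b + c | b. b \<in> rb_coboundaries2 G sc S \<psi>}"
  by (auto simp: cohomology_class_def a_r_coset_def' rb_cocycle_module_def)

lemma coboundary_iff:
  "(\<chi>', \<Phi>') \<in> rb_coboundaries2 G sc S \<psi> \<longleftrightarrow>
    (\<exists>f. Vector_Spaces.linear scG sc f \<and>
      (\<forall>x y. \<chi>' x y = \<psi> x (f y) - \<psi> y (f x) - f (bG x y)) \<and> (\<forall>x. \<Phi>' x = S (f x) - f (T x)))"
  by (auto simp: rb_coboundaries2_def fun_eq_iff)

lemma coboundaries_diff:
  assumes "c \<in> rb_coboundaries2 G sc S \<psi>" "d \<in> rb_coboundaries2 G sc S \<psi>"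
  shows "c - d \<in> rb_coboundaries2 G sc S \<psi>"
proof -
  obtain \<chi>1 \<Phi>1 \<chi>2 \<Phi>2 where cd: "c = (\<chi>1, \<Phi>1)" "d = (\<chi>2, \<Phi>2)" by fastforce
  obtain f g where fg: "Vector_Spaces.linear scG sc f" "Vector_Spaces.linear scG sc g"
    and eqs: "\<And>x y. \<chi>1 x y = \<psi> x (f y) - \<psi> y (f x) - f (bG x y)" "\<And>x. \<Phi>1 x = S (f x) - f (T x)"
      "\<And>x y. \<chi>2 x y = \<psi> x (g y) - \<psi> y (g x) - g (bG x y)" "\<And>x. \<Phi>2 x = S (g x) - g (T x)"
    using assms unfolding cd coboundary_iff by blast
  have "Vector_Spaces.linear scG sc (\<lambda>x. f x - g x)"
    using fg by (simp add: Vector_Spaces.linear_iff module.scale_right_diff_distrib module_iff_vector_space)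
  then show ?thesis
    unfolding cd minus_prod_def fst_conv snd_conv coboundary_iff
    by (intro exI[of _ "\<lambda>x. f x - g x"]) (simp add: eqs lin_simps algebra_simps)
qed

lemma zero_coboundary: "0 \<in> rb_coboundaries2 G sc S \<psi>"
proof -
  have "Vector_Spaces.linear scG sc (\<lambda>_. 0)"
    using spaces by (simp add: Vector_Spaces.linear_iff module.scale_zero_right module_iff_vector_space)
  then show ?thesis
    unfolding zero_prod_def coboundary_iff by (intro exI[of _ "\<lambda>_. 0"]) (simp add: lin_simps)
qed

text \<open>A class is the coset \<open>B + c\<close> and the zero class is \<open>B\<close> itself, so this is the coset
  criterion for the subgroup \<open>B\<close> of coboundaries.\<close>

lemma cohomology_class_zero_iff:
  "cohomology_class G sc S \<psi> c = \<zero>\<^bsub>H2_RBLie G sc S \<psi>\<^esub> \<longleftrightarrow> c \<in> rb_coboundaries2 G sc S \<psi>"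
proof -
  let ?B = "rb_coboundaries2 G sc S \<psi>"
  define K where "K = {b + c | b. b \<in> ?B}"
  have "K = ?B" if c: "c \<in> ?B"
  proof (intro equalityI subsetI)
    fix d assume "d \<in> K"
    then obtain b where b: "b \<in> ?B" "d = b + c" unfolding K_def by blast
    have "b - (0 - c) \<in> ?B"
      by (intro coboundaries_diff b zero_coboundary c)
    then show "d \<in> ?B" using b by simp
  next
    fix d assume "d \<in> ?B"
    then have "d - c \<in> ?B" by (rule coboundaries_diff[OF _ c])
    then show "d \<in> K"
      unfolding K_def by (intro CollectI exI[of _ "d - c"]) simp
  qed
  moreover have "c \<in> K"
    using zero_coboundary unfolding K_def by (intro CollectI exI[of _ 0]) simp
  moreover have "\<zero>\<^bsub>H2_RBLie G sc S \<psi>\<^esub> = ?B"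
    by (simp add: H2_RBLie_def quot_module_def)
  ultimately show ?thesis
    unfolding cohomology_class_eq K_def[symmetric] by auto
qed

lemma cohomology_class_in_H2:
  "c \<in> rb_cocycles2 G sc S \<psi> \<Longrightarrow> cohomology_class G sc S \<psi> c \<in> carrier (H2_RBLie G sc S \<psi>)"
  by (auto simp: cohomology_class_def H2_RBLie_def quot_module_def A_RCOSETS_def' rb_cocycle_module_def)

abbreviation "C\<^sub>\<psi> \<equiv> compatible_pairs G sc S \<psi>"

lemma compatible_pair_iff:
  "(\<beta>, \<alpha>) \<in> carrier C\<^sub>\<psi> \<longleftrightarrow>
    Vector_Spaces.linear sc sc \<beta> \<and> bij \<beta> \<and> (\<forall>h. S (\<beta> h) = \<beta> (S h)) \<and>
    Vector_Spaces.linear scG scG \<alpha> \<and> bij \<alpha> \<and> (\<forall>x y. \<alpha> (bG x y) = bG (\<alpha> x) (\<alpha> y)) \<and>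
    (\<forall>x. T (\<alpha> x) = \<alpha> (T x)) \<and> (\<forall>x h. \<beta> (\<psi> x h) = \<psi> (\<alpha> x) (\<beta> h))"
  by (auto simp: compatible_pairs_def rb_aut_def rb_morphism_def rb_abelian_def fun_eq_iff
      dest: linear_preserves(1))

lemma group_compatible_pairs: "group C\<^sub>\<psi>"
proof -
  let ?A = "rb_aut (rb_abelian sc S)" and ?B = "rb_aut G"
  have vs: "vector_space (rb_scale (rb_abelian sc S))"
    using spaces by (simp add: rb_abelian_def)
  have A: "group ?A" and B: "group ?B"
    using vs spaces by (auto intro: group_rb_aut)
  have AB: "group (?A \<times>\<times> ?B)"
    by (rule DirProd_group[OF A B])
  let ?H = "{(\<beta>, \<alpha>) \<in> carrier ?A \<times> carrier ?B. \<forall>x h. \<beta> (\<psi> x h) = \<psi> (\<alpha> x) (\<beta> h)}"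
  have "subgroup ?H (?A \<times>\<times> ?B)"
  proof (rule group.subgroupI[OF AB])
    have "\<one>\<^bsub>?A \<times>\<times> ?B\<^esub> \<in> ?H"
      using monoid.one_closed[OF group.is_monoid[OF A]] monoid.one_closed[OF group.is_monoid[OF B]]
      by (simp add: rb_aut_def)
    then show "?H \<noteq> {}" by blast
  next
    fix c assume c: "c \<in> ?H"
    obtain \<beta> \<alpha> where c_eq: "c = (\<beta>, \<alpha>)" by fastforce
    have mem: "\<beta> \<in> carrier ?A" "\<alpha> \<in> carrier ?B" and comp: "\<And>x h. \<beta> (\<psi> x h) = \<psi> (\<alpha> x) (\<beta> h)"
      using c by (auto simp: c_eq)
    have bij: "bij \<beta>" "bij \<alpha>" using mem by (auto simp: rb_aut_def)
    have "inv_into UNIV \<beta> (\<psi> x h) = \<psi> (inv_into UNIV \<alpha> x) (inv_into UNIV \<beta> h)" for x h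
      using comp[of "inv_into UNIV \<alpha> x" "inv_into UNIV \<beta> h"] bij
      by (metis bij_inv_eq_iff)
    then show "inv\<^bsub>?A \<times>\<times> ?B\<^esub> c \<in> ?H"
      using mem group.inv_closed[OF A mem(1)] group.inv_closed[OF B mem(2)]
      by (simp add: c_eq inv_DirProd[OF A B] rb_aut_inv vs spaces)
  next
    fix c d assume "c \<in> ?H" "d \<in> ?H"
    then show "c \<otimes>\<^bsub>?A \<times>\<times> ?B\<^esub> d \<in> ?H"
      using monoid.m_closed[OF group.is_monoid[OF A]] monoid.m_closed[OF group.is_monoid[OF B]]
      by (auto simp: rb_aut_def)
  qed auto
  then show ?thesis
    unfolding compatible_pairs_def by (rule subgroup.subgroup_is_group[OF _ AB])
qed

text \<open>Compatibility gives \<open>\<psi> x (\<beta> h) = \<beta> (\<psi> (\<alpha>\<inverse> x) h)\<close>, and \<open>\<alpha>\<inverse>\<close> respects the bracket and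
  \<open>T\<close>. Hence each cocycle condition for the twist at \<open>x, y, z\<close> is \<open>\<beta>\<close> applied to the original
  condition at \<open>\<alpha>\<inverse> x, \<alpha>\<inverse> y, \<alpha>\<inverse> z\<close>.\<close>

lemma twist_in_cocycles:
  assumes c: "c \<in> carrier C\<^sub>\<psi>" and d: "d \<in> rb_cocycles2 G sc S \<psi>"
  shows "twist_cochain c d \<in> rb_cocycles2 G sc S \<psi>"
proof -
  obtain \<beta> \<alpha> \<chi>' \<Phi>' where cd: "c = (\<beta>, \<alpha>)" "d = (\<chi>', \<Phi>')" by fastforce
  define a where "a = inv_into UNIV \<alpha>"
  have lin_\<beta>: "Vector_Spaces.linear sc sc \<beta>" and \<beta>S: "\<And>h. S (\<beta> h) = \<beta> (S h)"
    and \<alpha>: "rb_morphism G G \<alpha>" "bij \<alpha>"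
    and comp: "\<And>x h. \<beta> (\<psi> x h) = \<psi> (\<alpha> x) (\<beta> h)"
    using c by (auto simp: cd compatible_pair_iff rb_morphism_def fun_eq_iff)
  have "rb_morphism G G a"
    unfolding a_def by (rule rb_morphism_inverse[OF \<alpha>(1)]) (simp_all only: inv_into_UNIV_comp \<alpha>)
  then have lin_a: "Vector_Spaces.linear scG scG a"
    and a_br: "\<And>x y. a (bG x y) = bG (a x) (a y)" and a_T: "\<And>x. a (T x) = T (a x)"
    by (auto simp: rb_morphism_def fun_eq_iff)
  have \<psi>\<beta>: "\<psi> x (\<beta> h) = \<beta> (\<psi> (a x) h)" for x h
    using \<alpha>(2) by (simp add: comp a_def bij_is_surj surj_f_inv_f)
  note \<beta>_simps = linear_preserves(1)[OF lin_\<beta>] linear_preserves(2-3)[OF lin_\<beta>, symmetric]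
  have cocycle: "\<And>x y z. \<psi> x (\<chi>' y z) - \<psi> y (\<chi>' x z) + \<psi> z (\<chi>' x y)
       - \<chi>' (bG x y) z + \<chi>' (bG x z) y - \<chi>' (bG y z) x = 0"
    and lin: "\<And>y. Vector_Spaces.linear scG sc (\<lambda>x. \<chi>' x y)" "\<And>x. Vector_Spaces.linear scG sc (\<chi>' x)"
      "Vector_Spaces.linear scG sc \<Phi>'" and alt: "\<And>x. \<chi>' x x = 0"
    and rb: "\<And>x y. \<psi> (T x) (\<Phi>' y) - \<psi> (T y) (\<Phi>' x) - S (\<psi> x (\<Phi>' y) - \<psi> y (\<Phi>' x))
       - \<Phi>' (bG (T x) y + bG x (T y)) + \<chi>' (T x) (T y) - S (\<chi>' (T x) y + \<chi>' x (T y)) = 0"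
    using d by (auto simp: cd rb_cocycles2_def ce_cocycle2_def)
  have "Vector_Spaces.linear scG sc (\<lambda>x. \<beta> (\<chi>' (a x) (a y)))"
    "Vector_Spaces.linear scG sc (\<lambda>x. \<beta> (\<chi>' (a y) (a x)))"
    "Vector_Spaces.linear scG sc (\<lambda>x. \<beta> (\<Phi>' (a x)))" for y
    using Vector_Spaces.linear_compose[OF Vector_Spaces.linear_compose[OF lin_a lin(1)] lin_\<beta>]
      Vector_Spaces.linear_compose[OF Vector_Spaces.linear_compose[OF lin_a lin(2)] lin_\<beta>]
      Vector_Spaces.linear_compose[OF Vector_Spaces.linear_compose[OF lin_a lin(3)] lin_\<beta>]
    by (simp_all add: comp_def)
  then show ?thesis
    unfolding cd twist_cochain_def rb_cocycles2_def ce_cocycle2_def prod.case mem_Collect_eq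
      a_def[symmetric] a_br a_T \<psi>\<beta> \<beta>S linear_preserves(2)[OF lin_a]
    by (simp add: \<beta>S \<psi>\<beta> \<beta>_simps cocycle alt rb)
qed

section \<open>The pair induced by an automorphism of the extension\<close>

lemma aut_ext_iff:
  "\<gamma> \<in> carrier (aut_ext E i) \<longleftrightarrow> rb_morphism E E \<gamma> \<and> bij \<gamma> \<and> \<gamma> ` range i = range i"
  by (auto simp: aut_ext_def rb_aut_def)

lemma tau_i:
  assumes "\<gamma> \<in> carrier (aut_ext E i)"
  shows "\<gamma> (i h) = i (fst (tau i p s \<gamma>) h)"
proof -
  have "\<gamma> (i h) \<in> range i" using assms by (auto simp: aut_ext_iff)
  then show ?thesis by (auto simp: tau_def ext_inj)
qed

text \<open>\<open>p \<circ> \<gamma>\<close> kills \<open>range i\<close> and hence factors through \<open>p\<close>; this makes \<open>tau\<close> multiplicative,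
  although \<open>s \<circ> p\<close> is not the identity.\<close>

lemma tau_p:
  assumes "\<gamma> \<in> carrier (aut_ext E i)"
  shows "p (\<gamma> e) = snd (tau i p s \<gamma>) (p e)"
proof -
  have "Vector_Spaces.linear scE scE \<gamma>" using assms by (simp add: aut_ext_iff rb_morphism_def)
  then have "\<gamma> e = \<gamma> (s (p e)) + \<gamma> (i (fib e))"
    by (metis decompose linear_preserves(2))
  then show ?thesis by (simp add: tau_i[OF assms] lin_simps) (simp add: tau_def)
qed

lemma tau_comp:
  assumes "\<gamma> \<in> carrier (aut_ext E i)" "\<gamma>' \<in> carrier (aut_ext E i)"
  shows "tau i p s (\<gamma> \<circ> \<gamma>') = (fst (tau i p s \<gamma>) \<circ> fst (tau i p s \<gamma>'), snd (tau i p s \<gamma>) \<circ> snd (tau i p s \<gamma>'))"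
proof -
  have "tau i p s (\<gamma> \<circ> \<gamma>') = (inv_into UNIV i \<circ> (\<gamma> \<circ> (\<gamma>' \<circ> i)), p \<circ> \<gamma> \<circ> (\<gamma>' \<circ> s))"
    by (simp add: tau_def comp_assoc)
  then show ?thesis
    by (simp add: fun_eq_iff tau_i assms ext_inj tau_p)
qed

lemma tau_id: "tau i p s id = (id, id)"
  by (simp add: tau_def fun_eq_iff ext_inj)

text \<open>Bijectivity comes from multiplicativity of \<open>tau\<close> applied to \<open>\<gamma>\<close> and its inverse.
  For compatibility, \<open>\<gamma> (s x)\<close> and \<open>s (\<alpha> x)\<close> differ by an element of \<open>range i\<close>, which acts
  trivially on \<open>range i\<close>.\<close>

lemma tau_in_compatible_pairs:
  assumes \<gamma>: "\<gamma> \<in> carrier (aut_ext E i)"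
  shows "tau i p s \<gamma> \<in> carrier C\<^sub>\<psi>"
proof -
  obtain \<beta> \<alpha> where tau: "tau i p s \<gamma> = (\<beta>, \<alpha>)" by fastforce
  have \<gamma>_i: "\<gamma> (i h) = i (\<beta> h)" and \<gamma>_p: "p (\<gamma> e) = \<alpha> (p e)" for h e
    using tau_i[OF \<gamma>] tau_p[OF \<gamma>] by (simp_all add: tau)
  have lin: "Vector_Spaces.linear scE scE \<gamma>" and br: "\<And>d e. \<gamma> (bE d e) = bE (\<gamma> d) (\<gamma> e)"
    and op: "\<And>e. \<gamma> (U e) = U (\<gamma> e)"
    using \<gamma> by (auto simp: aut_ext_iff rb_morphism_def fun_eq_iff)
  interpret Aut: group "aut_ext E i" by (rule group_aut_ext[OF spaces(3)])
  obtain \<delta> where \<delta>: "\<delta> \<in> carrier (aut_ext E i)" "\<delta> \<circ> \<gamma> = id" "\<gamma> \<circ> \<delta> = id"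
    using Aut.inv_closed[OF \<gamma>] Aut.l_inv[OF \<gamma>] Aut.r_inv[OF \<gamma>] by (auto simp: aut_ext_def rb_aut_def)
  then have "fst (tau i p s \<delta>) \<circ> \<beta> = id" "\<beta> \<circ> fst (tau i p s \<delta>) = id"
    "snd (tau i p s \<delta>) \<circ> \<alpha> = id" "\<alpha> \<circ> snd (tau i p s \<delta>) = id"
    using tau_comp[OF \<delta>(1) \<gamma>] tau_comp[OF \<gamma> \<delta>(1)] by (simp_all add: tau tau_id)
  then have bij: "bij \<beta>" "bij \<alpha>" by (auto intro: o_bij)
  have lin_\<beta>: "Vector_Spaces.linear sc sc \<beta>"
    unfolding Vector_Spaces.linear_iff i_eq_iff[symmetric]
    by (simp add: spaces lin_simps scale_simps linear_preserves[OF lin] flip: \<gamma>_i)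
  have "\<alpha> = p \<circ> (\<gamma> \<circ> s)" by (simp add: fun_eq_iff \<gamma>_p)
  then have lin_\<alpha>: "Vector_Spaces.linear scG scG \<alpha>"
    using Vector_Spaces.linear_compose[OF Vector_Spaces.linear_compose[OF lin_s lin] lin_p] by simp
  have "S (\<beta> h) = \<beta> (S h)" for h
    unfolding i_eq_iff[symmetric] by (metis \<gamma>_i i_op op)
  moreover have "\<alpha> (bG x y) = bG (\<alpha> x) (\<alpha> y)" for x y
    by (metis \<gamma>_p br p_bracket p_s)
  moreover have "T (\<alpha> x) = \<alpha> (T x)" for x
    by (metis \<gamma>_p op p_op p_s)
  moreover have "\<beta> (\<psi> x h) = \<psi> (\<alpha> x) (\<beta> h)" for x h
  proof -
    have "i (\<beta> (\<psi> x h)) = bE (\<gamma> (s x)) (\<gamma> (i h))"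
      by (metis br bracket_s_i \<gamma>_i)
    also have "\<gamma> (s x) = s (\<alpha> x) + i (fib (\<gamma> (s x)))"
      using decompose[of "\<gamma> (s x)"] by (simp add: \<gamma>_p)
    finally show ?thesis
      by (simp add: \<gamma>_i lin_simps bracket_s_i bracket_i_i)
  qed
  ultimately show ?thesis
    by (simp add: tau compatible_pair_iff bij lin_\<beta> lin_\<alpha>)
qed

lemma tau_hom: "tau i p s \<in> hom (aut_ext E i) C\<^sub>\<psi>"
proof (rule homI)
  fix \<gamma> \<gamma>' assume \<gamma>: "\<gamma> \<in> carrier (aut_ext E i)" "\<gamma>' \<in> carrier (aut_ext E i)"
  have "\<gamma> \<otimes>\<^bsub>aut_ext E i\<^esub> \<gamma>' = \<gamma> \<circ> \<gamma>'"
    by (simp add: aut_ext_def rb_aut_def)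
  then show "tau i p s (\<gamma> \<otimes>\<^bsub>aut_ext E i\<^esub> \<gamma>') = tau i p s \<gamma> \<otimes>\<^bsub>C\<^sub>\<psi>\<^esub> tau i p s \<gamma>'"
    by (simp add: tau_comp[OF \<gamma>] compatible_pairs_def rb_aut_def mult_DirProd')
qed (rule tau_in_compatible_pairs)

section \<open>Lifting a compatible pair\<close>

text \<open>The block triangular map with diagonal blocks \<open>\<alpha>\<close>, \<open>\<beta>\<close>. The off-diagonal block is
  \<open>f \<circ> \<alpha>\<close> rather than \<open>f\<close> because twisting involves \<open>\<alpha>\<inverse>\<close>; with this choice the
  morphism condition becomes the coboundary equation for \<open>f\<close> itself.\<close>

definition lift :: "('h \<Rightarrow> 'h) \<Rightarrow> ('g \<Rightarrow> 'g) \<Rightarrow> ('g \<Rightarrow> 'h) \<Rightarrow> 'e \<Rightarrow> 'e" where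
  "lift \<beta> \<alpha> f e = s (\<alpha> (p e)) + i (f (\<alpha> (p e)) + \<beta> (fib e))"

lemma lift_decomposed: "lift \<beta> \<alpha> f (s x + i h) = s (\<alpha> x) + i (f (\<alpha> x) + \<beta> h)"
  by (simp add: lift_def lin_simps)

text \<open>Comparing \<open>'h\<close>-components in the coordinate formulas for bracket and operator, the terms
  in \<open>h\<close> and \<open>k\<close> cancel by compatibility of \<open>(\<beta>, \<alpha>)\<close>; what is left is the coboundary equation
  at arguments of the form \<open>\<alpha> x\<close>.\<close>

lemma lift_morphism_iff:
  assumes c: "(\<beta>, \<alpha>) \<in> carrier C\<^sub>\<psi>" and f: "Vector_Spaces.linear scG sc f"
  shows "rb_morphism E E (lift \<beta> \<alpha> f) \<longleftrightarrow>
    twist_cochain (\<beta>, \<alpha>) (\<chi>, \<Phi>) - (\<chi>, \<Phi>)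
      = (\<lambda>x y. \<psi> x (f y) - \<psi> y (f x) - f (bG x y), \<lambda>x. S (f x) - f (T x))"
proof -
  have lin_\<beta>: "Vector_Spaces.linear sc sc \<beta>" and \<beta>S: "\<And>h. S (\<beta> h) = \<beta> (S h)"
    and lin_\<alpha>: "Vector_Spaces.linear scG scG \<alpha>" and "bij \<alpha>"
    and \<alpha>_br: "\<And>x y. \<alpha> (bG x y) = bG (\<alpha> x) (\<alpha> y)" and \<alpha>_T: "\<And>x. \<alpha> (T x) = T (\<alpha> x)"
    and comp: "\<And>x h. \<beta> (\<psi> x h) = \<psi> (\<alpha> x) (\<beta> h)"
    using c by (auto simp: compatible_pair_iff)
  let ?g = "lift \<beta> \<alpha> f" and ?a = "inv_into UNIV \<alpha>"
  note lin = linear_preserves[OF lin_\<beta>] linear_preserves[OF f] linear_preserves[OF lin_\<alpha>]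
  \<comment> \<open>Both quantifier laws are substitutions along a surjection: \<open>\<alpha>\<close> for arguments in \<open>'g\<close>,
    and \<open>(x, h) \<mapsto> s x + i h\<close> for arguments in \<open>'e\<close>.\<close>
  have all_\<alpha>: "(\<forall>x. P x) \<longleftrightarrow> (\<forall>x. P (\<alpha> x))" for P
    using \<open>bij \<alpha>\<close> by (metis bij_inv_eq_iff)
  have all_e: "(\<forall>e. P e) \<longleftrightarrow> (\<forall>x h. P (s x + i h))" for P
    by (metis decompose)
  have a_\<alpha>: "?a (\<alpha> x) = x" for x
    using \<open>bij \<alpha>\<close> by (simp add: bij_is_inj)
  have lin_lift: "Vector_Spaces.linear scE scE ?g"
    using spaces unfolding Vector_Spaces.linear_iff lift_def
    by (simp add: lin lin_simps scale_simps fib_simps linear_preserves(5)[OF linear_fib] algebra_simps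
        module.scale_right_distrib module_iff_vector_space)
  have br: "?g (bE (s x + i h) (s y + i k)) = bE (?g (s x + i h)) (?g (s y + i k)) \<longleftrightarrow>
      \<beta> (\<chi> x y) - \<chi> (\<alpha> x) (\<alpha> y) = \<psi> (\<alpha> x) (f (\<alpha> y)) - \<psi> (\<alpha> y) (f (\<alpha> x)) - f (bG (\<alpha> x) (\<alpha> y))"
    for x y h k
    unfolding bracket_decomposed lift_decomposed decomposed_eq_iff
    by (auto simp: lin lin_\<psi>2[THEN linear_preserves(2)] \<alpha>_br comp algebra_simps)
  have op: "U (?g (s x + i h)) = ?g (U (s x + i h)) \<longleftrightarrow>
      \<beta> (\<Phi> x) - \<Phi> (\<alpha> x) = S (f (\<alpha> x)) - f (T (\<alpha> x))" for x h
    unfolding op_decomposed lift_decomposed decomposed_eq_iff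
    by (auto simp: lin lin_S[THEN linear_preserves(2)] \<alpha>_T \<beta>S algebra_simps)
  have "rb_morphism E E ?g \<longleftrightarrow>
      (\<forall>x y. \<beta> (\<chi> x y) - \<chi> (\<alpha> x) (\<alpha> y)
         = \<psi> (\<alpha> x) (f (\<alpha> y)) - \<psi> (\<alpha> y) (f (\<alpha> x)) - f (bG (\<alpha> x) (\<alpha> y))) \<and>
      (\<forall>x. \<beta> (\<Phi> x) - \<Phi> (\<alpha> x) = S (f (\<alpha> x)) - f (T (\<alpha> x)))"
    unfolding rb_morphism_def fun_eq_iff comp_apply
    by (subst (1 2 3) all_e) (simp add: lin_lift br op)
  also have "\<dots> \<longleftrightarrow>
      (\<forall>x y. \<beta> (\<chi> (?a x) (?a y)) - \<chi> x y = \<psi> x (f y) - \<psi> y (f x) - f (bG x y)) \<and>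
      (\<forall>x. \<beta> (\<Phi> (?a x)) - \<Phi> x = S (f x) - f (T x))"
    by (subst (3 4 5) all_\<alpha>) (simp add: a_\<alpha>)
  finally show ?thesis
    by (simp add: twist_cochain_def fun_eq_iff)
qed

lemma lift_in_aut_ext:
  assumes c: "(\<beta>, \<alpha>) \<in> carrier C\<^sub>\<psi>" and f: "Vector_Spaces.linear scG sc f"
    and mor: "rb_morphism E E (lift \<beta> \<alpha> f)"
  shows "lift \<beta> \<alpha> f \<in> carrier (aut_ext E i)" "tau i p s (lift \<beta> \<alpha> f) = (\<beta>, \<alpha>)"
proof -
  let ?g = "lift \<beta> \<alpha> f"
  have bij: "bij \<beta>" "bij \<alpha>" and zero: "\<alpha> 0 = 0" "\<beta> 0 = 0" "f 0 = 0"
    using c f by (auto simp: compatible_pair_iff linear_preserves(1))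
  have g_i: "?g (i h) = i (\<beta> h)" for h
    using lift_decomposed[of \<beta> \<alpha> f 0 h] by (simp add: zero lin_simps)
  have "inj ?g"
  proof (rule injI)
    fix d e assume "?g d = ?g e"
    then have "p d = p e" "fib d = fib e"
      using bij by (auto simp: lift_def bij_is_inj inj_eq)
    then show "d = e" using decompose[of d] decompose[of e] by simp
  qed
  moreover have "e \<in> range ?g" for e
  proof -
    \<comment> \<open>The triangular system is solved by back substitution.\<close>
    obtain x h where "\<alpha> x = p e" "\<beta> h = fib e - f (p e)"
      using bij by (metis bij_is_surj surj_def)
    then have "?g (s x + i h) = e"
      using decompose[of e] by (simp add: lift_decomposed)
    then show ?thesis by (metis rangeI)
  qed
  ultimately have "bij ?g" by (auto simp: bij_def)
  moreover have "?g ` range i = i ` range \<beta>"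
    by (auto simp: g_i image_image)
  ultimately show "?g \<in> carrier (aut_ext E i)"
    using mor bij by (simp add: aut_ext_iff bij_is_surj)
  have "inv_into UNIV i \<circ> ?g \<circ> i = \<beta>"
    by (simp add: fun_eq_iff g_i ext_inj)
  moreover have "p \<circ> ?g \<circ> s = \<alpha>"
    by (simp add: fun_eq_iff lift_def lin_simps)
  ultimately show "tau i p s ?g = (\<beta>, \<alpha>)"
    by (simp add: tau_def)
qed

text \<open>The off-diagonal block of \<open>\<gamma>\<close> is \<open>fib \<circ> \<gamma> \<circ> s\<close>, and it has to equal \<open>f \<circ> \<alpha>\<close>.\<close>

lemma aut_ext_is_lift:
  assumes \<gamma>: "\<gamma> \<in> carrier (aut_ext E i)" and tau: "tau i p s \<gamma> = (\<beta>, \<alpha>)"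
  obtains f where "Vector_Spaces.linear scG sc f" "\<gamma> = lift \<beta> \<alpha> f"
proof
  let ?f = "fib \<circ> (\<gamma> \<circ> (s \<circ> inv_into UNIV \<alpha>))"
  have \<alpha>: "rb_morphism G G \<alpha>" "bij \<alpha>"
    using tau_in_compatible_pairs[OF \<gamma>] by (auto simp: tau compatible_pair_iff rb_morphism_def fun_eq_iff)
  have lin: "Vector_Spaces.linear scE scE \<gamma>" using \<gamma> by (simp add: aut_ext_iff rb_morphism_def)
  have "rb_morphism G G (inv_into UNIV \<alpha>)"
    by (rule rb_morphism_inverse[OF \<alpha>(1)]) (simp_all only: inv_into_UNIV_comp \<alpha>)
  then have "Vector_Spaces.linear scG scG (inv_into UNIV \<alpha>)"
    by (simp add: rb_morphism_def)
  then show "Vector_Spaces.linear scG sc ?f"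
    by (intro Vector_Spaces.linear_compose) (assumption | rule lin_s lin linear_fib)+
  show "\<gamma> = lift \<beta> \<alpha> ?f"
  proof
    fix e
    have "\<gamma> e = \<gamma> (s (p e)) + \<gamma> (i (fib e))"
      by (metis decompose lin linear_preserves(2))
    also have "\<gamma> (s (p e)) = s (\<alpha> (p e)) + i (fib (\<gamma> (s (p e))))"
      using decompose[of "\<gamma> (s (p e))"] tau_p[OF \<gamma>, of "s (p e)"] by (simp add: tau)
    also have "\<gamma> (i (fib e)) = i (\<beta> (fib e))"
      by (simp add: tau_i[OF \<gamma>] tau)
    finally show "\<gamma> e = lift \<beta> \<alpha> ?f e"
      using \<alpha> by (simp add: lift_def lin_simps bij_is_inj add.assoc)
  qed
qed

section \<open>Exactness\<close>

lemma wells_map_in_H2: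
  "c \<in> carrier C\<^sub>\<psi> \<Longrightarrow> wells_map G sc S \<psi> E i s c \<in> carrier (H2_RBLie G sc S \<psi>)"
  unfolding wells_map_def ext_cocycle_eq
  by (intro cohomology_class_in_H2 cocycles_diff twist_in_cocycles ext_cocycle_in_cocycles)

lemma wells_map_zero_iff:
  assumes c: "c \<in> carrier C\<^sub>\<psi>"
  shows "wells_map G sc S \<psi> E i s c = \<zero>\<^bsub>H2_RBLie G sc S \<psi>\<^esub> \<longleftrightarrow>
    c \<in> tau i p s ` carrier (aut_ext E i)"
proof -
  obtain \<beta> \<alpha> where c_eq: "c = (\<beta>, \<alpha>)" by fastforce
  note c = c[unfolded c_eq]
  have "wells_map G sc S \<psi> E i s (\<beta>, \<alpha>) = \<zero>\<^bsub>H2_RBLie G sc S \<psi>\<^esub> \<longleftrightarrow>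
      (\<exists>f. Vector_Spaces.linear scG sc f \<and> rb_morphism E E (lift \<beta> \<alpha> f))"
    unfolding wells_map_def ext_cocycle_eq cohomology_class_zero_iff
    using lift_morphism_iff[OF c] by (auto simp: rb_coboundaries2_def)
  also have "\<dots> \<longleftrightarrow> (\<beta>, \<alpha>) \<in> tau i p s ` carrier (aut_ext E i)"
  proof
    assume "\<exists>f. Vector_Spaces.linear scG sc f \<and> rb_morphism E E (lift \<beta> \<alpha> f)"
    then show "(\<beta>, \<alpha>) \<in> tau i p s ` carrier (aut_ext E i)"
      using lift_in_aut_ext[OF c] by (metis image_eqI)
  next
    assume "(\<beta>, \<alpha>) \<in> tau i p s ` carrier (aut_ext E i)"
    then obtain \<gamma> where \<gamma>: "\<gamma> \<in> carrier (aut_ext E i)" "tau i p s \<gamma> = (\<beta>, \<alpha>)" by auto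
    then obtain f where f: "Vector_Spaces.linear scG sc f" "\<gamma> = lift \<beta> \<alpha> f"
      by (rule aut_ext_is_lift)
    have "rb_morphism E E \<gamma>" using \<gamma> by (simp add: aut_ext_iff)
    with f show "\<exists>f. Vector_Spaces.linear scG sc f \<and> rb_morphism E E (lift \<beta> \<alpha> f)" by blast
  qed
  finally show ?thesis by (simp add: c_eq)
qed

lemma aut_ext_fix_kernel:
  "aut_ext_fix E i p s = (aut_ext E i)\<lparr>carrier := kernel (aut_ext E i) C\<^sub>\<psi> (tau i p s)\<rparr>"
  by (simp add: aut_ext_fix_def kernel_def compatible_pairs_def rb_aut_def)

end

theorem theorem6p5:
  fixes G :: "('k::field_char_0, 'g::ab_group_add) rb_lie"
    and sc :: "'k \<Rightarrow> 'h::ab_group_add \<Rightarrow> 'h"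
    and S :: "'h \<Rightarrow> 'h"
    and \<psi> :: "'g \<Rightarrow> 'h \<Rightarrow> 'h"
    and E :: "('k, 'e::ab_group_add) rb_lie"
    and i :: "'h \<Rightarrow> 'e"
    and p :: "'e \<Rightarrow> 'g"
    and s :: "'g \<Rightarrow> 'e"
  assumes "rb_abelian_extension G sc S \<psi> E i p"
    and "rb_section G E p s"
  shows "group (aut_ext_fix E i p s) \<and> group (aut_ext E i) \<and> group (compatible_pairs G sc S \<psi>) \<and>
    (\<lambda>\<gamma>. \<gamma>) \<in> hom (aut_ext_fix E i p s) (aut_ext E i) \<and>
    tau i p s \<in> hom (aut_ext E i) (compatible_pairs G sc S \<psi>) \<and>
    wells_map G sc S \<psi> E i s \<in> carrier (compatible_pairs G sc S \<psi>) \<rightarrow> carrier (H2_RBLie G sc S \<psi>) \<and>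
    inj_on (\<lambda>\<gamma>. \<gamma>) (carrier (aut_ext_fix E i p s)) \<and>
    (\<lambda>\<gamma>. \<gamma>) ` carrier (aut_ext_fix E i p s)
      = kernel (aut_ext E i) (compatible_pairs G sc S \<psi>) (tau i p s) \<and>
    tau i p s ` carrier (aut_ext E i)
      = {c \<in> carrier (compatible_pairs G sc S \<psi>).
           wells_map G sc S \<psi> E i s c = \<zero>\<^bsub>H2_RBLie G sc S \<psi>\<^esub>}"
proof -
  interpret ext: rb_split_extension G sc S \<psi> E i p s
    using assms by (simp add: rb_split_extension_def rb_split_extension_axioms_def)
  let ?A = "aut_ext E i" and ?C = "compatible_pairs G sc S \<psi>"
  have A: "group ?A" by (rule group_aut_ext[OF ext.spaces(3)])
  interpret tau: group_hom ?A ?C "tau i p s"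
    using A ext.group_compatible_pairs ext.tau_hom by (simp add: group_hom_def group_hom_axioms_def)
  have "group (aut_ext_fix E i p s)"
    unfolding ext.aut_ext_fix_kernel by (rule subgroup.subgroup_is_group[OF tau.subgroup_kernel A])
  moreover have "(\<lambda>\<gamma>. \<gamma>) \<in> hom (aut_ext_fix E i p s) ?A"
    by (auto simp: hom_def aut_ext_fix_def)
  moreover have "tau i p s ` carrier ?A
      = {c \<in> carrier ?C. wells_map G sc S \<psi> E i s c = \<zero>\<^bsub>H2_RBLie G sc S \<psi>\<^esub>}"
    using ext.wells_map_zero_iff ext.tau_in_compatible_pairs by blast
  moreover have "wells_map G sc S \<psi> E i s \<in> carrier ?C \<rightarrow> carrier (H2_RBLie G sc S \<psi>)"
    using ext.wells_map_in_H2 by blast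
  ultimately show ?thesis
    using A ext.group_compatible_pairs ext.tau_hom by (simp add: ext.aut_ext_fix_kernel)
qed

end
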